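(* Let $(X,\nu)$ be a Menger's 2-probabilistic normed space and let $F$ be a convex series compact subset of $X$. Then (1) $F$ is convex series closed, and (2) $F$ is bounded. The converse is true if $X$ is complete: if $(X,\nu)$ is a complete Menger's 2-probabilistic normed space and $F\subseteq X$ is convex series closed and bounded, then $F$ is convex series compact.
   Context: A distribution function is a nondecreasing function $F:[-\infty,+\infty]\to[0,1]$ that is left-continuous on $\mathbb{R}$ with $F(-\infty)=0$, $F(+\infty)=1$. $\mathcal{D}$ denotes the set of proper distribution functions, i.e. those with $\lim_{x\to-\infty}F(x)=0$ and $\lim_{x\to+\infty}F(x)=1$. A Menger's 2-probabilistic normed space (Menger's 2-PN space) is a pair $(X,\nu)$ where $X$ is a real vector space with $\dim X>1$ and $\nu:X\times X\to\mathcal{D}$, $(x,y)\mapsto\nu_{x,y}$, satisfies: (A1) $\nu_{x,y}(0)=0$ for all $x,y\in X$; (A2) $\nu_{x,y}(t)=1$ for all $t>0$ if and only if $x,y$ are linearly dependent; (A3) $\nu_{x,y}(t)=\nu_{y,x}(t)$ for all $x,y\in X$, $t\in\mathbb{R}$; (A4) $\nu_{\alpha x,y}(t)=\nu_{x,y}(t/|\alpha|)$ for all $\alpha\in\mathbb{R}\setminus\{0\}$, $x,y\in X$, $t\in\mathbb{R}$; (A5) $\nu_{x+y,z}(s+t)\ge\min\{\nu_{x,z}(s),\nu_{y,z}(t)\}$ for all $x,y,z\in X$, $s,t\in\mathbb{R}$. A sequence $(x_n)$ in $X$ converges to $x\in X$ if $\lim_{n\to\infty}\nu_{x_n-x,z}(t)=1$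 for all $z\in X$ and $t>0$. It is Cauchy if for all $z\in X$, $t>0$, $\lim_{n\to\infty}\nu_{x_m-x_n,z}(t)=1$ with $m>n$ (i.e. for every $\alpha\in(0,1)$ there is $n_0$ with $\nu_{x_m-x_n,z}(t)>1-\alpha$ for all $m>n>n_0$). $X$ is complete if every Cauchy sequence in $X$ converges to a point of $X$. A series converges to its sum $x$ if its sequence of partial sums converges to $x$. A convex series of elements of $F\subseteq X$ is a series $\sum_{n=1}^\infty\lambda_nx_n$ with $x_n\in F$, $\lambda_n\ge0$ for each $n$ and $\sum_{n=1}^\infty\lambda_n=1$. $F$ is convex series closed if $F$ contains the sum of every convergent convex series of its elements. $F$ is convex series compact if every convex series of its elements is convergent to a point of $F$. A subset $F$ of $X$ is bounded if for every $r\in(0,1)$ there exists $t_0>0$ such that $\nu_{x,y}(t_0)>1-r$ for every $x\in F$ and $y\in X$.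
   Formalization: In the definition of bounded, t_0 is allowed to depend on y (uniform only over x in F); with t_0 uniform in y as well, only subsets of {0} would be bounded, and part (2) would fail for every singleton {p} with p ≠ 0. *)

theory Defs
  imports Complex_Main "HOL-Library.Extended_Real"
begin

definition distribution_function :: "(ereal \<Rightarrow> real) \<Rightarrow> bool" where
  "distribution_function F \<longleftrightarrow>
     mono F \<and> (\<forall>t. 0 \<le> F t \<and> F t \<le> 1) \<and>
     (\<forall>t::real. continuous (at_left t) (\<lambda>s. F (ereal s))) \<and>
     F (-\<infinity>) = 0 \<and> F \<infinity> = 1"

definition proper_distribution_function :: "(ereal \<Rightarrow> real) \<Rightarrow> bool" where
  "proper_distribution_function F \<longleftrightarrow>
     distribution_function F \<and>
     ((\<lambda>t::real. F (ereal t)) \<longlongrightarrow> 0) at_bot \<and>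
     ((\<lambda>t::real. F (ereal t)) \<longlongrightarrow> 1) at_top"

(* Dependence of the family (x, y). This differs from "dependent {x, y}" when x = y is nonzero:
   the set then collapses to a singleton and is independent. *)
definition linearly_dependent_pair :: "'a::real_vector \<Rightarrow> 'a \<Rightarrow> bool" where
  "linearly_dependent_pair x y \<longleftrightarrow>
     (\<exists>a b::real. (a \<noteq> 0 \<or> b \<noteq> 0) \<and> a *\<^sub>R x + b *\<^sub>R y = 0)"

(* The vector space X is the whole type 'a. The condition dim X > 1 is stated through a basis
   because the library function dim is 0 on infinite-dimensional spaces. *)
locale menger_2PN_space =
  fixes \<nu> :: "'a::real_vector \<Rightarrow> 'a \<Rightarrow> ereal \<Rightarrow> real"
  assumes dim_gt_1: "\<exists>B::'a set. independent B \<and> span B = UNIV \<and> (infinite B \<or> card B > 1)"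
    and proper: "proper_distribution_function (\<nu> x y)"
    and A1: "\<nu> x y 0 = 0"
    and A2: "(\<forall>t::real. t > 0 \<longrightarrow> \<nu> x y (ereal t) = 1) \<longleftrightarrow> linearly_dependent_pair x y"
    and A3: "\<nu> x y (ereal t) = \<nu> y x (ereal t)"
    and A4: "\<alpha> \<noteq> 0 \<Longrightarrow> \<nu> (\<alpha> *\<^sub>R x) y (ereal t) = \<nu> x y (ereal (t / \<bar>\<alpha>\<bar>))"
    and A5: "\<nu> (x + y) z (ereal (s + t)) \<ge> min (\<nu> x z (ereal s)) (\<nu> y z (ereal t))"

definition pn_converges_to ::
  "('a::real_vector \<Rightarrow> 'a \<Rightarrow> ereal \<Rightarrow> real) \<Rightarrow> (nat \<Rightarrow> 'a) \<Rightarrow> 'a \<Rightarrow> bool" where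
  "pn_converges_to \<nu> X l \<longleftrightarrow>
     (\<forall>z. \<forall>t::real. t > 0 \<longrightarrow> (\<lambda>n. \<nu> (X n - l) z (ereal t)) \<longlonglongrightarrow> 1)"

definition pn_Cauchy ::
  "('a::real_vector \<Rightarrow> 'a \<Rightarrow> ereal \<Rightarrow> real) \<Rightarrow> (nat \<Rightarrow> 'a) \<Rightarrow> bool" where
  "pn_Cauchy \<nu> X \<longleftrightarrow>
     (\<forall>z. \<forall>t::real. t > 0 \<longrightarrow>
        (\<forall>\<alpha>::real. 0 < \<alpha> \<and> \<alpha> < 1 \<longrightarrow>
           (\<exists>n0. \<forall>m n. m > n \<and> n > n0 \<longrightarrow> \<nu> (X m - X n) z (ereal t) > 1 - \<alpha>)))"

definition pn_complete :: "('a::real_vector \<Rightarrow> 'a \<Rightarrow> ereal \<Rightarrow> real) \<Rightarrow> bool" where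
  "pn_complete \<nu> \<longleftrightarrow> (\<forall>X. pn_Cauchy \<nu> X \<longrightarrow> (\<exists>l. pn_converges_to \<nu> X l))"

definition pn_sums ::
  "('a::real_vector \<Rightarrow> 'a \<Rightarrow> ereal \<Rightarrow> real) \<Rightarrow> (nat \<Rightarrow> 'a) \<Rightarrow> 'a \<Rightarrow> bool" where
  "pn_sums \<nu> u s \<longleftrightarrow> pn_converges_to \<nu> (\<lambda>n. \<Sum>k<n. u k) s"

(* Coefficients c and points x of a convex series of elements of F, indexed from 0. *)
definition convex_series :: "'a::real_vector set \<Rightarrow> (nat \<Rightarrow> real) \<Rightarrow> (nat \<Rightarrow> 'a) \<Rightarrow> bool" where
  "convex_series F c x \<longleftrightarrow> (\<forall>n. x n \<in> F) \<and> (\<forall>n. c n \<ge> 0) \<and> c sums 1"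

definition convex_series_closed ::
  "('a::real_vector \<Rightarrow> 'a \<Rightarrow> ereal \<Rightarrow> real) \<Rightarrow> 'a set \<Rightarrow> bool" where
  "convex_series_closed \<nu> F \<longleftrightarrow>
     (\<forall>c x s. convex_series F c x \<and> pn_sums \<nu> (\<lambda>n. c n *\<^sub>R x n) s \<longrightarrow> s \<in> F)"

definition convex_series_compact ::
  "('a::real_vector \<Rightarrow> 'a \<Rightarrow> ereal \<Rightarrow> real) \<Rightarrow> 'a set \<Rightarrow> bool" where
  "convex_series_compact \<nu> F \<longleftrightarrow>
     (\<forall>c x. convex_series F c x \<longrightarrow> (\<exists>s\<in>F. pn_sums \<nu> (\<lambda>n. c n *\<^sub>R x n) s))"

(* The bound t0 is uniform in x in F but may depend on y. A bound uniform in y as well would,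
   by A3 and A4 applied to multiples of y, give nu x y t = 1 for all t > 0 and all y, so by A2
   and dim X > 1 only subsets of {0} would be bounded. *)
definition pn_bounded ::
  "('a::real_vector \<Rightarrow> 'a \<Rightarrow> ereal \<Rightarrow> real) \<Rightarrow> 'a set \<Rightarrow> bool" where
  "pn_bounded \<nu> F \<longleftrightarrow>
     (\<forall>y. \<forall>r::real. 0 < r \<and> r < 1 \<longrightarrow>
        (\<exists>t0::real. t0 > 0 \<and> (\<forall>x\<in>F. \<nu> x y (ereal t0) > 1 - r)))"

end

theory Submission
  imports Defs
begin

text \<open>
  Boundedness is necessary: if it fails at \<open>y\<close>, choose \<open>x\<^sub>n \<in> F\<close> with
  \<open>\<nu>\<^bsub>x\<^sub>n,y\<^esub>(2\<^bsup>n+1\<^esup>) \<le> 1 - r\<close>; the terms of the convex series \<open>\<Sum> 2\<^bsup>-(n+1)\<^esup> x\<^sub>n\<close> do not tend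
  to \<open>0\<close>. Conversely, a bound \<open>t\<^sub>0\<close> for \<open>F\<close> gives the bound \<open>t\<^sub>0 \<Sum> \<lambda>\<^sub>k\<close> for finite sums
  \<open>\<Sum> \<lambda>\<^sub>k x\<^sub>k\<close>, because the triangle inequality with \<open>min\<close> loses nothing in the level \<open>1 - r\<close>;
  hence the partial sums of a convex series are Cauchy.
\<close>

context menger_2PN_space
begin

lemma nu_le_1: "\<nu> x z t \<le> 1"
  using proper[of x z]
  by (auto simp: proper_distribution_function_def distribution_function_def)

lemma nu_zero: "0 < t \<Longrightarrow> \<nu> 0 z (ereal t) = 1"
  using A2[of 0 z] by (auto simp: linearly_dependent_pair_def intro: exI[of _ 1])

lemma nu_uminus: "\<nu> (- x) z (ereal t) = \<nu> x z (ereal t)"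
  using A4[of "-1" x z t] by simp

lemma nu_diff: "min (\<nu> x z (ereal s)) (\<nu> y z (ereal t)) \<le> \<nu> (x - y) z (ereal (s + t))"
  using A5[of x z s "- y" t] by (simp add: nu_uminus)

text \<open>If every \<open>z\<close> depended on \<open>d\<close>, then \<open>d\<close> would span
  the space and independent sets would have at most one element, contradicting
  \<open>dim_gt_1\<close>. Through A2, such a \<open>z\<close> separates \<open>d\<close> from
  \<open>0\<close>; uniqueness of limits rests on this.\<close>

lemma exists_independent_partner:
  fixes d :: 'a
  assumes "d \<noteq> 0"
  shows "\<exists>z. \<not> linearly_dependent_pair d z"
proof (rule ccontr)
  assume "\<not> ?thesis"
  then have dep: "linearly_dependent_pair d z" for z by blast
  have "z \<in> span {d}" for z
  proof -
    obtain a b where ab: "a \<noteq> 0 \<or> b \<noteq> 0" "a *\<^sub>R d + b *\<^sub>R z = 0"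
      using dep[of z] unfolding linearly_dependent_pair_def by blast
    with assms have b: "b \<noteq> 0" by auto
    from ab have "b *\<^sub>R z = (- a) *\<^sub>R d"
      by (metis add.commute eq_neg_iff_add_eq_0 scaleR_minus_left)
    with b have "z = (- a / b) *\<^sub>R d"
      by (metis divide_inverse_commute scaleR_one scaleR_scaleR left_inverse)
    then show ?thesis
      by (metis span_base span_scale singletonI)
  qed
  then have "finite B \<and> card B \<le> 1" if "independent B" for B :: "'a set"
    using independent_span_bound[of "{d}" B] that by auto
  with dim_gt_1 show False by (meson not_le)
qed

lemma pn_converges_to_diff:
  assumes "pn_converges_to \<nu> X a" "pn_converges_to \<nu> Y b"
  shows "pn_converges_to \<nu> (\<lambda>n. X n - Y n) (a - b)"
  unfolding pn_converges_to_def
proof (intro allI impI)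
  fix z and t :: real
  assume "t > 0"
  then have "(\<lambda>n. \<nu> (X n - a) z (ereal (t/2))) \<longlonglongrightarrow> 1" "(\<lambda>n. \<nu> (Y n - b) z (ereal (t/2))) \<longlonglongrightarrow> 1"
    using assms by (simp_all add: pn_converges_to_def)
  then have "(\<lambda>n. min (\<nu> (X n - a) z (ereal (t/2))) (\<nu> (Y n - b) z (ereal (t/2)))) \<longlonglongrightarrow> min 1 1"
    by (rule tendsto_min)
  then have lower: "(\<lambda>n. min (\<nu> (X n - a) z (ereal (t/2))) (\<nu> (Y n - b) z (ereal (t/2)))) \<longlonglongrightarrow> 1"
    by simp
  have "min (\<nu> (X n - a) z (ereal (t/2))) (\<nu> (Y n - b) z (ereal (t/2)))
      \<le> \<nu> (X n - Y n - (a - b)) z (ereal t)" for n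
    using nu_diff[of "X n - a" z "t/2" "Y n - b" "t/2"] by (simp add: algebra_simps)
  then show "(\<lambda>n. \<nu> (X n - Y n - (a - b)) z (ereal t)) \<longlonglongrightarrow> 1"
    by (intro tendsto_sandwich[OF _ _ lower tendsto_const[of 1]]) (auto simp: nu_le_1)
qed

lemma pn_converges_to_unique:
  assumes "pn_converges_to \<nu> X a" "pn_converges_to \<nu> X b"
  shows "a = b"
proof (rule ccontr)
  assume "a \<noteq> b"
  then obtain z where z: "\<not> linearly_dependent_pair (b - a) z"
    using exists_independent_partner[of "b - a"] by auto
  \<comment> \<open>\<open>X\<close> minus itself is the constant sequence \<open>0\<close> with
    limit \<open>a - b\<close>, so the constants \<open>\<nu> (0 - (a - b)) z t\<close> tend to 1
    and hence equal 1.\<close>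
  have "\<nu> (b - a) z (ereal t) = 1" if "t > 0" for t
    using pn_converges_to_diff[OF assms] that
    by (auto simp: pn_converges_to_def LIMSEQ_const_iff)
  with A2 z show False by blast
qed

lemma pn_sums_imp_terms_converge_to_0:
  assumes "pn_sums \<nu> u s"
  shows "pn_converges_to \<nu> u 0"
proof -
  let ?S = "\<lambda>n. \<Sum>k<n. u k"
  have S: "pn_converges_to \<nu> ?S s" using assms by (simp add: pn_sums_def)
  \<comment> \<open>The term \<open>u n\<close> is \<open>?S (Suc n) - ?S n\<close>, a difference of
    two sequences with the same limit \<open>s\<close>.\<close>
  have "pn_converges_to \<nu> (\<lambda>n. ?S (Suc n)) s"
    unfolding pn_converges_to_def
  proof (intro allI impI)
    fix z and t :: real
    assume "t > 0"
    with S have "(\<lambda>n. \<nu> (?S n - s) z (ereal t)) \<longlonglongrightarrow> 1" by (simp add: pn_converges_to_def)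
    then show "(\<lambda>n. \<nu> (?S (Suc n) - s) z (ereal t)) \<longlonglongrightarrow> 1" by (rule LIMSEQ_Suc)
  qed
  from pn_converges_to_diff[OF this S] show ?thesis by simp
qed

text \<open>The inequality \<open>t > t\<^sub>0 \<Sum> c\<^sub>k\<close> is strict because \<open>\<nu>\<^bsub>0,z\<^esub>(0) = 0\<close>, so it would fail for
  vanishing coefficients otherwise.\<close>

lemma nu_weighted_sum_gt:
  assumes "finite A" and "\<And>k. k \<in> A \<Longrightarrow> 0 \<le> c k"
    and "\<And>k. k \<in> A \<Longrightarrow> \<nu> (x k) z (ereal t0) > l" and "l < 1"
    and "(\<Sum>k\<in>A. c k) * t0 < t"
  shows "\<nu> (\<Sum>k\<in>A. c k *\<^sub>R x k) z (ereal t) > l"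
  using assms
proof (induction A arbitrary: t rule: finite_induct)
  case empty
  then show ?case by (simp add: nu_zero)
next
  case (insert k A)
  \<comment> \<open>The share \<open>c k * t0\<close> of \<open>t\<close> is set aside for the new
    term; the rest still strictly exceeds \<open>t0\<close> times the weight of
    \<open>A\<close>.\<close>
  have IH: "\<nu> (\<Sum>k\<in>A. c k *\<^sub>R x k) z (ereal (t - c k * t0)) > l"
    using insert by (intro insert.IH) (auto simp: algebra_simps)
  show ?case
  \<comment> \<open>A4 rescales only by nonzero scalars. For \<open>c k = 0\<close> both the new
    term and its share of \<open>t\<close> vanish, leaving the induction hypothesis.\<close>
  proof (cases "c k = 0")
    case True
    with IH insert.hyps show ?thesis by simp
  next
    case False
    then have "\<nu> (c k *\<^sub>R x k) z (ereal (c k * t0)) = \<nu> (x k) z (ereal t0)"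
      using A4[of "c k" "x k" z "c k * t0"] insert.prems(1)[of k] by simp
    with insert.prems(2)[of k] have "\<nu> (c k *\<^sub>R x k) z (ereal (c k * t0)) > l" by simp
    with IH A5[where x = "c k *\<^sub>R x k" and s = "c k * t0" and z = z
        and y = "\<Sum>k\<in>A. c k *\<^sub>R x k" and t = "t - c k * t0"]
    show ?thesis using insert.hyps by simp
  qed
qed

text \<open>Compactness provides a sum in \<open>F\<close>, and by uniqueness of limits it is the
  given one.\<close>

lemma convex_series_compact_imp_closed:
  assumes "convex_series_compact \<nu> F"
  shows "convex_series_closed \<nu> F"
  using assms pn_converges_to_unique
  unfolding convex_series_compact_def convex_series_closed_def pn_sums_def by blast

lemma convex_series_compact_imp_bounded:
  assumes "convex_series_compact \<nu> F"
  shows "pn_bounded \<nu> F"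
proof (rule ccontr)
  assume "\<not> pn_bounded \<nu> F"
  then obtain y r where r: "0 < r" "r < 1"
    and unb: "\<And>t0::real. t0 > 0 \<Longrightarrow> \<exists>x\<in>F. \<nu> x y (ereal t0) \<le> 1 - r"
    unfolding pn_bounded_def by (meson not_le)
  have "\<forall>n. \<exists>x. x \<in> F \<and> \<nu> x y (ereal (2 ^ Suc n)) \<le> 1 - r"
    using unb by (metis zero_less_numeral zero_less_power)
  then obtain x where x: "\<And>n. x n \<in> F" "\<And>n. \<nu> (x n) y (ereal (2 ^ Suc n)) \<le> 1 - r"
    by metis
  \<comment> \<open>The exponent \<open>Suc n\<close> makes the weights, indexed from 0, add up to
    1, and \<open>c n\<close> is the reciprocal of the scale \<open>2 ^ Suc n\<close> chosen for
    \<open>x n\<close>.\<close>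
  define c where "c n = (1/2::real) ^ Suc n" for n
  have "convex_series F c x"
    using x power_half_series by (auto simp: convex_series_def c_def[abs_def])
  with assms obtain s where "pn_sums \<nu> (\<lambda>n. c n *\<^sub>R x n) s"
    unfolding convex_series_compact_def by blast
  from pn_sums_imp_terms_converge_to_0[OF this]
  have "(\<lambda>n. \<nu> (c n *\<^sub>R x n) y (ereal 1)) \<longlonglongrightarrow> 1"
    by (auto simp: pn_converges_to_def dest: spec[of _ y] spec[of _ 1])
  then have "eventually (\<lambda>n. \<nu> (c n *\<^sub>R x n) y (ereal 1) > 1 - r) sequentially"
    using r by (intro order_tendstoD) auto
  \<comment> \<open>By A4 the value at 1 is that of \<open>x n\<close> at
    \<open>1 / c n = 2 ^ Suc n\<close>.\<close>
  moreover have "\<nu> (c n *\<^sub>R x n) y (ereal 1) \<le> 1 - r" for n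
    using A4[of "c n" "x n" y 1] x(2)[of n] by (simp add: c_def power_one_over)
  ultimately show False
    by (auto simp: eventually_sequentially not_less[symmetric])
qed

lemma convex_series_partial_sums_Cauchy:
  assumes "pn_bounded \<nu> F" "convex_series F c x"
  shows "pn_Cauchy \<nu> (\<lambda>n. \<Sum>k<n. c k *\<^sub>R x k)"
  unfolding pn_Cauchy_def
proof (intro allI impI)
  fix z and t \<alpha> :: real
  assume t: "t > 0" and \<alpha>: "0 < \<alpha> \<and> \<alpha> < 1"
  have x: "\<And>n. x n \<in> F" and c: "\<And>n. c n \<ge> 0" and c1: "c sums 1"
    using assms(2) by (auto simp: convex_series_def)
  obtain t0 where t0: "t0 > 0" and bd: "\<And>u. u \<in> F \<Longrightarrow> \<nu> u z (ereal t0) > 1 - \<alpha>"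
    using assms(1) \<alpha> unfolding pn_bounded_def by meson
  \<comment> \<open>The threshold \<open>t / t0\<close> makes the bound
    \<open>t0 * sum c {m..<n}\<close> for late blocks of the series smaller than
    \<open>t\<close>.\<close>
  have "\<exists>N. \<forall>m\<ge>N. \<forall>n. norm (sum c {m..<n}) < t / t0"
    using c1 t t0 by (intro summable_Cauchy[THEN iffD1, rule_format]) (auto simp: sums_iff)
  then obtain N where N: "\<And>m n. m \<ge> N \<Longrightarrow> norm (sum c {m..<n}) < t / t0" by blast
  have "\<nu> ((\<Sum>k<m. c k *\<^sub>R x k) - (\<Sum>k<n. c k *\<^sub>R x k)) z (ereal t) > 1 - \<alpha>"
    if mn: "m > n" "n > N" for m n
  proof -
    have "sum c {n..<m} < t / t0" using N[of n m] mn by simp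
    then have "sum c {n..<m} * t0 < t" using t0 by (simp add: field_simps)
    then have "\<nu> (\<Sum>k\<in>{n..<m}. c k *\<^sub>R x k) z (ereal t) > 1 - \<alpha>"
      using \<alpha> by (intro nu_weighted_sum_gt[OF _ c bd[OF x]]) auto
    moreover have "(\<Sum>k<m. c k *\<^sub>R x k) - (\<Sum>k<n. c k *\<^sub>R x k) = (\<Sum>k\<in>{n..<m}. c k *\<^sub>R x k)"
      using mn sum_diff_nat_ivl[of 0 n m "\<lambda>k. c k *\<^sub>R x k"] by (simp add: atLeast0LessThan)
    ultimately show ?thesis by simp
  qed
  then show "\<exists>n0. \<forall>m n. m > n \<and> n > n0 \<longrightarrow>
      \<nu> ((\<Sum>k<m. c k *\<^sub>R x k) - (\<Sum>k<n. c k *\<^sub>R x k)) z (ereal t) > 1 - \<alpha>"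
    by blast
qed

text \<open>Boundedness makes the partial sums Cauchy, completeness gives them a limit, and
  closedness places it in \<open>F\<close>.\<close>

lemma complete_closed_bounded_imp_convex_series_compact:
  assumes "pn_complete \<nu>" "convex_series_closed \<nu> F" "pn_bounded \<nu> F"
  shows "convex_series_compact \<nu> F"
  using assms convex_series_partial_sums_Cauchy
  unfolding convex_series_compact_def convex_series_closed_def pn_complete_def pn_sums_def
  by meson

end

theorem theorem2p3:
  fixes \<nu> :: "'a::real_vector \<Rightarrow> 'a \<Rightarrow> ereal \<Rightarrow> real"
    and F :: "'a set"
  assumes "menger_2PN_space \<nu>"
  shows "(convex_series_compact \<nu> F \<longrightarrow> convex_series_closed \<nu> F \<and> pn_bounded \<nu> F) \<and>
         (pn_complete \<nu> \<and> convex_series_closed \<nu> F \<and> pn_bounded \<nu> F \<longrightarrow>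
            convex_series_compact \<nu> F)"
proof -
  interpret menger_2PN_space \<nu> by fact
  show ?thesis
    using convex_series_compact_imp_closed convex_series_compact_imp_bounded
      complete_closed_bounded_imp_convex_series_compact by blast
qed

end
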